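(* Let $E$ and $L$ be locally convex spaces. Then $E\times L$ is strongly Gelfand--Phillips if and only if both $E$ and $L$ are strongly Gelfand--Phillips.
   Context: All locally convex spaces are Hausdorff and infinite-dimensional over the field $\mathbb{F}$ of real or complex numbers. A barrel is a closed absolutely convex absorbing subset. A subset $B$ of a locally convex space $H$ is barrel-bounded if for every barrel $U\subseteq H$ there is $n\in\omega$ with $B\subseteq nU$. A set $A\subseteq H$ is barrel-precompact if for every barrel $U\subseteq H$ there is a finite set $F\subseteq H$ with $A\subseteq F+U$. For $B\subseteq H$ and $\chi\in H'$, $\|\chi\|_B:=\sup\{|\chi(x)|:x\in B\cup\{0\}\}$. $H$ is strongly Gelfand--Phillips if there is a weak$^\ast$ null sequence $\{\chi_n\}_{n\in\omega}$ in $H'$ such that $\|\chi_n\|_B\not\to 0$ for every barrel-bounded set $B\subseteq H$ which is not barrel-precompact. *)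

theory Defs
  imports "HOL-Analysis.Analysis"
begin

text \<open>
  The scalar field is an arbitrary type \<open>'f :: real_normed_field\<close>; both \<open>real\<close> and \<open>complex\<close> are
  instances and, by the Gelfand--Mazur theorem, they are the only ones up to isometric isomorphism.
  As type classes only provide real scalar multiplication, the scalar multiplication is an explicit
  parameter \<open>s\<close>, as in \<^locale>\<open>vector_space\<close>; addition and topology are those of the type.
\<close>

definition convex_set :: "('f::real_normed_field \<Rightarrow> 'a::ab_group_add \<Rightarrow> 'a) \<Rightarrow> 'a set \<Rightarrow> bool" where
  "convex_set s U \<longleftrightarrow>
     (\<forall>x\<in>U. \<forall>y\<in>U. \<forall>t::real. 0 \<le> t \<and> t \<le> 1 \<longrightarrow> s (of_real (1 - t)) x + s (of_real t) y \<in> U)"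

definition balanced_set :: "('f::real_normed_field \<Rightarrow> 'a::ab_group_add \<Rightarrow> 'a) \<Rightarrow> 'a set \<Rightarrow> bool" where
  "balanced_set s U \<longleftrightarrow> (\<forall>x\<in>U. \<forall>c. norm c \<le> 1 \<longrightarrow> s c x \<in> U)"

definition absorbing_set :: "('f::real_normed_field \<Rightarrow> 'a::ab_group_add \<Rightarrow> 'a) \<Rightarrow> 'a set \<Rightarrow> bool" where
  "absorbing_set s U \<longleftrightarrow> (\<forall>x. \<exists>r>0. \<forall>c. norm c \<ge> r \<longrightarrow> x \<in> s c ` U)"

text \<open>
  Hausdorff and infinite-dimensional by convention. Continuity of addition is an assumption of the
  locale because the library has no instance of \<^class>\<open>topological_ab_group_add\<close> for products;
  continuity of negation follows from continuity of scalar multiplication.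
\<close>

locale locally_convex_space = vector_space s
  for s :: "'f::real_normed_field \<Rightarrow> 'a::{ab_group_add, t2_space} \<Rightarrow> 'a" +
  assumes continuous_add: "continuous_on UNIV (\<lambda>(x, y). x + y :: 'a)"
    and continuous_scale: "continuous_on UNIV (\<lambda>(c, x). s c x)"
    and locally_convex:
      "\<And>W. open W \<Longrightarrow> 0 \<in> W \<Longrightarrow> \<exists>V. open V \<and> 0 \<in> V \<and> V \<subseteq> W \<and> convex_set s V"
    and infinite_dimensional: "\<nexists>S. finite S \<and> span S = UNIV"

definition barrel ::
    "('f::real_normed_field \<Rightarrow> 'a::{ab_group_add, topological_space} \<Rightarrow> 'a) \<Rightarrow> 'a set \<Rightarrow> bool" where
  "barrel s U \<longleftrightarrow> closed U \<and> convex_set s U \<and> balanced_set s U \<and> absorbing_set s U"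

definition barrel_bounded ::
    "('f::real_normed_field \<Rightarrow> 'a::{ab_group_add, topological_space} \<Rightarrow> 'a) \<Rightarrow> 'a set \<Rightarrow> bool" where
  "barrel_bounded s B \<longleftrightarrow> (\<forall>U. barrel s U \<longrightarrow> (\<exists>n::nat. B \<subseteq> s (of_nat n) ` U))"

definition barrel_precompact ::
    "('f::real_normed_field \<Rightarrow> 'a::{ab_group_add, topological_space} \<Rightarrow> 'a) \<Rightarrow> 'a set \<Rightarrow> bool" where
  "barrel_precompact s A \<longleftrightarrow>
     (\<forall>U. barrel s U \<longrightarrow> (\<exists>F. finite F \<and> A \<subseteq> {x + u |x u. x \<in> F \<and> u \<in> U}))"

definition topological_dual ::
    "('f::real_normed_field \<Rightarrow> 'a::{ab_group_add, topological_space} \<Rightarrow> 'a) \<Rightarrow> ('a \<Rightarrow> 'f) set" where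
  "topological_dual s = {\<phi>. Vector_Spaces.linear s (*) \<phi> \<and> continuous_on UNIV \<phi>}"

definition weak_star_null ::
    "('f::real_normed_field \<Rightarrow> 'a::{ab_group_add, topological_space} \<Rightarrow> 'a) \<Rightarrow> (nat \<Rightarrow> 'a \<Rightarrow> 'f) \<Rightarrow> bool"
  where
  "weak_star_null s \<phi> \<longleftrightarrow> (\<forall>n. \<phi> n \<in> topological_dual s) \<and> (\<forall>x. (\<lambda>n. \<phi> n x) \<longlonglongrightarrow> 0)"

text \<open>Valued in \<^typ>\<open>ennreal\<close>, so that the supremum is meaningful on any set \<open>B\<close>.\<close>

definition sup_seminorm :: "'a::ab_group_add set \<Rightarrow> ('a \<Rightarrow> 'f::real_normed_field) \<Rightarrow> ennreal" where
  "sup_seminorm B \<phi> = (SUP x\<in>B \<union> {0}. ennreal (norm (\<phi> x)))"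

definition strongly_Gelfand_Phillips ::
    "('f::real_normed_field \<Rightarrow> 'a::{ab_group_add, topological_space} \<Rightarrow> 'a) \<Rightarrow> bool" where
  "strongly_Gelfand_Phillips s \<longleftrightarrow>
     (\<exists>\<phi>. weak_star_null s \<phi> \<and>
       (\<forall>B. barrel_bounded s B \<and> \<not> barrel_precompact s B \<longrightarrow>
          \<not> (\<lambda>n. sup_seminorm B (\<phi> n)) \<longlonglongrightarrow> 0))"

text \<open>
  The space \<open>E \<times> L\<close> carries the product topology and componentwise addition of the product type,
  and the componentwise scalar multiplication \<^const>\<open>module_prod.scale\<close> of the library.
\<close>

lemma locally_convex_space_prod:
  fixes sE :: "'f::real_normed_field \<Rightarrow> 'e::{ab_group_add, t2_space} \<Rightarrow> 'e"
    and sL :: "'f \<Rightarrow> 'l::{ab_group_add, t2_space} \<Rightarrow> 'l"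
  assumes "locally_convex_space sE" and "locally_convex_space sL"
  shows "locally_convex_space (module_prod.scale sE sL)"
proof -
  interpret E: locally_convex_space sE by fact
  interpret L: locally_convex_space sL by fact
  interpret P: vector_space_prod sE sL ..
  have addE: "continuous_on UNIV (\<lambda>z. f z + g z)"
    if "continuous_on UNIV f" "continuous_on UNIV g"
    for f g :: "('e \<times> 'l) \<times> ('e \<times> 'l) \<Rightarrow> 'e"
    using continuous_on_compose2[OF E.continuous_add continuous_on_Pair[OF that]] by simp
  have addL: "continuous_on UNIV (\<lambda>z. f z + g z)"
    if "continuous_on UNIV f" "continuous_on UNIV g"
    for f g :: "('e \<times> 'l) \<times> ('e \<times> 'l) \<Rightarrow> 'l"
    using continuous_on_compose2[OF L.continuous_add continuous_on_Pair[OF that]] by simp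
  have scE: "continuous_on UNIV (\<lambda>z. sE (f z) (g z))"
    if "continuous_on UNIV f" "continuous_on UNIV g" for f and g :: "'f \<times> ('e \<times> 'l) \<Rightarrow> 'e"
    using continuous_on_compose2[OF E.continuous_scale continuous_on_Pair[OF that]] by simp
  have scL: "continuous_on UNIV (\<lambda>z. sL (f z) (g z))"
    if "continuous_on UNIV f" "continuous_on UNIV g" for f and g :: "'f \<times> ('e \<times> 'l) \<Rightarrow> 'l"
    using continuous_on_compose2[OF L.continuous_scale continuous_on_Pair[OF that]] by simp
  show ?thesis
  proof
    show "continuous_on UNIV (\<lambda>(x, y). x + y :: 'e \<times> 'l)"
      unfolding plus_prod_def case_prod_beta
      by (intro continuous_on_Pair addE addL continuous_intros)
    show "continuous_on UNIV (\<lambda>(c, x). P.scale c x)"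
      unfolding P.scale_def case_prod_beta
      by (intro continuous_on_Pair scE scL continuous_intros)
    show "\<exists>V. open V \<and> 0 \<in> V \<and> V \<subseteq> W \<and> convex_set P.scale V"
      if W: "open W" "0 \<in> W" for W
    proof -
      obtain A B where AB: "open A" "open B" "0 \<in> A \<times> B" "A \<times> B \<subseteq> W"
        using open_prod_elim[OF W] by blast
      obtain V1 where V1: "open V1" "0 \<in> V1" "V1 \<subseteq> A" "convex_set sE V1"
        using E.locally_convex[of A] AB by (auto simp: zero_prod_def)
      obtain V2 where V2: "open V2" "0 \<in> V2" "V2 \<subseteq> B" "convex_set sL V2"
        using L.locally_convex[of B] AB by (auto simp: zero_prod_def)
      have "convex_set P.scale (V1 \<times> V2)"
        using V1(4) V2(4) unfolding convex_set_def by (auto simp: P.scale_prod)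
      then show ?thesis
        using V1 V2 AB(4) by (intro exI[of _ "V1 \<times> V2"]) (auto simp: zero_prod_def intro: open_Times)
    qed
    show "\<nexists>S. finite S \<and> P.p.span S = UNIV"
    proof
      assume "\<exists>S. finite S \<and> P.p.span S = UNIV"
      then obtain S where S: "finite S" "P.p.span S = UNIV" by blast
      interpret F: module_hom P.scale sE fst by (unfold module_hom_eq_linear, fact P.linear_fst)
      have "E.span (fst ` S) = UNIV"
        using F.span_image[of S] S(2) by simp
      then show False using S(1) E.infinite_dimensional by blast
    qed
  qed
qed

end

theory Submission
  imports Defs
begin

text \<open>
  Continuous linear maps pull barrels back to barrels, hence preserve barrel-boundedness and
  barrel-precompactness. So the property passes to complemented subspaces by restricting the
  functionals. Conversely, interleave the sequences of \<open>E\<close> and \<open>L\<close>: a set in \<open>E \<times> L\<close> is contained in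
  the sum of (the copies of) its two projections, so if it is not barrel-precompact then one of the
  projections is not, and this is detected by the even or by the odd functionals.
\<close>

text \<open>Absorption is the only axiom needing work, since \<open>T\<close> need not be onto: a
  representation \<open>T x = t c u\<close> with \<open>c\<close> nonzero is divided by
  \<open>c\<close>, which puts \<open>s (inverse c) x\<close> into the preimage of
  \<open>U\<close>.\<close>

lemma barrel_vimage:
  fixes s :: "'f::real_normed_field \<Rightarrow> _" and T :: "'a::{ab_group_add, topological_space} \<Rightarrow> 'b::{ab_group_add, topological_space}"
  assumes T: "Vector_Spaces.linear s t T" "continuous_on UNIV T" and U: "barrel t U"
  shows "barrel s (T -` U)"
proof -
  interpret T: Vector_Spaces.linear s t T by fact
  have "x \<in> s c ` (T -` U)" if "T x \<in> t c ` U" "c \<noteq> 0" for x c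
  proof -
    from that(1) obtain u where u: "u \<in> U" "T x = t c u" by blast
    have "T (s (inverse c) x) = u"
      using that(2) by (simp add: T.scale u(2))
    moreover have "x = s c (s (inverse c) x)"
      using that(2) by simp
    ultimately show ?thesis
      using u(1) by blast
  qed
  \<comment> \<open>The condition \<open>r > 0\<close> in \<open>absorbing_set\<close> is what
    permits division by \<open>c\<close>.\<close>
  moreover have "c \<noteq> 0" if "0 < r" "r \<le> norm c" for r :: real and c :: 'f
    using that by auto
  ultimately have "absorbing_set s (T -` U)"
    using U unfolding barrel_def absorbing_set_def by meson
  moreover have "closed (T -` U)"
    using U T(2) by (simp add: barrel_def closed_vimage)
  moreover have "convex_set s (T -` U)" "balanced_set s (T -` U)"
    using U unfolding barrel_def convex_set_def balanced_set_def
    by (auto simp: T.add T.scale)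
  ultimately show ?thesis
    by (simp add: barrel_def)
qed

text \<open>The multiple \<open>n\<close> found for the pulled back barrel also serves for
  \<open>U\<close>, because \<open>T\<close> commutes with scaling.\<close>

lemma barrel_bounded_image:
  fixes T :: "'a::{ab_group_add, topological_space} \<Rightarrow> 'b::{ab_group_add, topological_space}"
  assumes T: "Vector_Spaces.linear s t T" "continuous_on UNIV T" and B: "barrel_bounded s B"
  shows "barrel_bounded t (T ` B)"
  unfolding barrel_bounded_def
proof (intro allI impI)
  interpret T: Vector_Spaces.linear s t T by fact
  fix U assume "barrel t U"
  then obtain n :: nat where "B \<subseteq> s (of_nat n) ` (T -` U)"
    using B barrel_vimage[OF T] unfolding barrel_bounded_def by blast
  then have "T ` B \<subseteq> t (of_nat n) ` U"
    by (force simp: T.scale)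
  then show "\<exists>n::nat. T ` B \<subseteq> t (of_nat n) ` U" ..
qed

lemma barrel_precompactE:
  assumes "barrel_precompact s A" "barrel s U"
  obtains F where "finite F" "A \<subseteq> {x + u |x u. x \<in> F \<and> u \<in> U}"
  using assms unfolding barrel_precompact_def by meson

text \<open>A finite set of centres for the pulled back barrel is mapped by \<open>T\<close> to
  centres for \<open>U\<close>.\<close>

lemma barrel_precompact_image:
  fixes T :: "'a::{ab_group_add, topological_space} \<Rightarrow> 'b::{ab_group_add, topological_space}"
  assumes T: "Vector_Spaces.linear s t T" "continuous_on UNIV T" and A: "barrel_precompact s A"
  shows "barrel_precompact t (T ` A)"
  unfolding barrel_precompact_def
proof (intro allI impI)
  interpret T: Vector_Spaces.linear s t T by fact
  fix U assume U: "barrel t U"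
  obtain F where F: "finite F" "A \<subseteq> {x + u |x u. x \<in> F \<and> u \<in> T -` U}"
    using barrel_precompactE[OF A barrel_vimage[OF T U]] .
  have "T ` A \<subseteq> {x + u |x u. x \<in> T ` F \<and> u \<in> U}"
  proof clarify
    fix a assume "a \<in> A"
    then obtain x u where "x \<in> F" "T u \<in> U" "a = x + u"
      using F(2) by blast
    then show "\<exists>y v. T a = y + v \<and> y \<in> T ` F \<and> v \<in> U"
      using T.add by blast
  qed
  with F(1) show "\<exists>F. finite F \<and> T ` A \<subseteq> {x + u |x u. x \<in> F \<and> u \<in> U}"
    by (intro exI[of _ "T ` F"]) simp
qed

lemma barrel_precompact_subset:
  "barrel_precompact s A \<Longrightarrow> B \<subseteq> A \<Longrightarrow> barrel_precompact s B"
  unfolding barrel_precompact_def by (meson order_trans)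

text \<open>Each summand is covered by finitely many translates of half of \<open>U\<close>; two
  halves add up to an element of \<open>U\<close> by convexity.\<close>

lemma (in locally_convex_space) barrel_precompact_plus:
  assumes "barrel_precompact s A" "barrel_precompact s B"
  shows "barrel_precompact s {a + b |a b. a \<in> A \<and> b \<in> B}"
  unfolding barrel_precompact_def
proof (intro allI impI)
  fix U assume U: "barrel s U"
  \<comment> \<open>This is \<open>U\<close> scaled by 1/2, written as a preimage under doubling so
    that \<open>barrel_vimage\<close> shows it to be a barrel.\<close>
  let ?V = "s 2 -` U"
  have "continuous_on UNIV (s 2)"
    using continuous_on_compose2[OF continuous_scale, of UNIV "\<lambda>x. (2, x)"]
    by (simp add: continuous_on_Pair)
  moreover have "Vector_Spaces.linear s s (s 2)"
    using module_hom_scale_self by (simp add: module_hom_iff_linear)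
  ultimately have V: "barrel s ?V"
    using U by (intro barrel_vimage)
  obtain F where F: "finite F" "A \<subseteq> {x + u |x u. x \<in> F \<and> u \<in> ?V}"
    using barrel_precompactE[OF assms(1) V] .
  obtain G where G: "finite G" "B \<subseteq> {x + u |x u. x \<in> G \<and> u \<in> ?V}"
    using barrel_precompactE[OF assms(2) V] .
  have half: "u + v \<in> U" if "u \<in> ?V" "v \<in> ?V" for u v
  proof -
    \<comment> \<open>The sum \<open>u + v\<close> is the midpoint of the doubled vectors, which lie
      in \<open>U\<close>.\<close>
    have "\<forall>r::real. 0 \<le> r \<and> r \<le> 1 \<longrightarrow> s (of_real (1 - r)) (s 2 u) + s (of_real r) (s 2 v) \<in> U"
      using U that unfolding barrel_def convex_set_def by blast
    from this[rule_format, of "1/2"] show ?thesis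
      by simp
  qed
  let ?H = "(\<lambda>(f, g). f + g) ` (F \<times> G)"
  have "{a + b |a b. a \<in> A \<and> b \<in> B} \<subseteq> {x + u |x u. x \<in> ?H \<and> u \<in> U}"
  proof clarify
    fix a b assume "a \<in> A" "b \<in> B"
    from \<open>a \<in> A\<close> obtain f u where *: "f \<in> F" "u \<in> ?V" "a = f + u"
      using F(2) by blast
    from \<open>b \<in> B\<close> obtain g v where **: "g \<in> G" "v \<in> ?V" "b = g + v"
      using G(2) by blast
    from * ** have "a + b = (f + g) + (u + v)" "f + g \<in> ?H"
      by (auto simp: algebra_simps)
    then show "\<exists>x w. a + b = x + w \<and> x \<in> ?H \<and> w \<in> U"
      using half[OF *(2) **(2)] by blast
  qed
  with F(1) G(1)
  show "\<exists>H. finite H \<and> {a + b |a b. a \<in> A \<and> b \<in> B} \<subseteq> {x + u |x u. x \<in> H \<and> u \<in> U}"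
    by (intro exI[of _ ?H] conjI finite_imageI finite_cartesian_product)
qed

lemma weak_star_null_compose:
  fixes T :: "'a::{ab_group_add, topological_space} \<Rightarrow> 'b::{ab_group_add, topological_space}"
  assumes T: "Vector_Spaces.linear s t T" "continuous_on UNIV T" and \<phi>: "weak_star_null t \<phi>"
  shows "weak_star_null s (\<lambda>n. \<phi> n \<circ> T)"
proof -
  have "Vector_Spaces.linear s (*) (\<phi> n \<circ> T)" "continuous_on UNIV (\<phi> n \<circ> T)" for n
    using \<phi> T unfolding weak_star_null_def topological_dual_def
    by (auto intro: Vector_Spaces.linear_compose continuous_on_compose continuous_on_subset
        simp del: o_apply)
  then show ?thesis
    using \<phi> unfolding weak_star_null_def topological_dual_def by simp
qed

text \<open>Linearity enters only through \<open>T 0 = 0\<close>, which matches the points 0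
  adjoined on both sides.\<close>

lemma sup_seminorm_image:
  assumes "Vector_Spaces.linear s t T"
  shows "sup_seminorm (T ` B) \<theta> = sup_seminorm B (\<theta> \<circ> T)"
proof -
  interpret T: Vector_Spaces.linear s t T by fact
  have "T ` B \<union> {0} = T ` (B \<union> {0})"
    by (simp add: T.zero)
  then show ?thesis
    by (simp add: sup_seminorm_def image_image)
qed

text \<open>The functionals are restricted along \<open>i\<close>. Boundedness is carried forward by
  \<open>i\<close>, whereas failure of precompactness is carried forward by means of the retraction
  \<open>p\<close>.\<close>

lemma strongly_Gelfand_Phillips_retract:
  fixes i :: "'a::{ab_group_add, topological_space} \<Rightarrow> 'b::{ab_group_add, topological_space}"
  assumes i: "Vector_Spaces.linear s t i" "continuous_on UNIV i"
    and p: "Vector_Spaces.linear t s p" "continuous_on UNIV p"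
    and retr: "\<And>x. p (i x) = x"
    and t: "strongly_Gelfand_Phillips t"
  shows "strongly_Gelfand_Phillips s"
proof -
  obtain \<theta> where \<theta>: "weak_star_null t \<theta>"
    "\<And>B. barrel_bounded t B \<Longrightarrow> \<not> barrel_precompact t B \<Longrightarrow> \<not> (\<lambda>n. sup_seminorm B (\<theta> n)) \<longlonglongrightarrow> 0"
    using t unfolding strongly_Gelfand_Phillips_def by blast
  have "\<not> (\<lambda>n. sup_seminorm B (\<theta> n \<circ> i)) \<longlonglongrightarrow> 0"
    if B: "barrel_bounded s B" "\<not> barrel_precompact s B" for B
  proof -
    have "\<not> barrel_precompact t (i ` B)"
      using barrel_precompact_image[OF p, of "i ` B"] B(2) by (auto simp: image_image retr)
    then show ?thesis
      using \<theta>(2)[OF barrel_bounded_image[OF i B(1)]] by (simp add: sup_seminorm_image[OF i(1)])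
  qed
  then show ?thesis
    using weak_star_null_compose[OF i \<theta>(1)] unfolding strongly_Gelfand_Phillips_def by blast
qed

text \<open>Both sequences survive as subsequences, so neither can hide the other; in termwise sums
  of functionals the contributions of the two factors could cancel.\<close>

definition interleave :: "(nat \<Rightarrow> 'a) \<Rightarrow> (nat \<Rightarrow> 'a) \<Rightarrow> nat \<Rightarrow> 'a" where
  "interleave f g n = (if even n then f (n div 2) else g (n div 2))"

lemma interleave_even [simp]: "interleave f g (2 * n) = f n"
  and interleave_odd [simp]: "interleave f g (Suc (2 * n)) = g n"
  by (simp_all add: interleave_def)

lemma weak_star_null_interleave:
  assumes "weak_star_null s \<phi>" "weak_star_null s \<psi>"
  shows "weak_star_null s (interleave \<phi> \<psi>)"
proof -
  have div2: "filterlim (\<lambda>n::nat. n div 2) sequentially sequentially"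
    unfolding filterlim_at_top
  proof
    fix k :: nat
    show "\<forall>\<^sub>F n in sequentially. k \<le> n div 2"
      using eventually_ge_at_top[of "2 * k"] by eventually_elim simp
  qed
  have "(\<lambda>n. \<phi> (n div 2) x) \<longlonglongrightarrow> 0" "(\<lambda>n. \<psi> (n div 2) x) \<longlonglongrightarrow> 0" for x
    using assms by (auto simp: weak_star_null_def intro: filterlim_compose[OF _ div2])
  \<comment> \<open>Each branch is needed only along the indices of one parity, a finer filter than
    \<open>sequentially\<close>.\<close>
  then have "(\<lambda>n. if even n then \<phi> (n div 2) x else \<psi> (n div 2) x) \<longlonglongrightarrow> 0" for x
    by (intro filterlim_If filterlim_mono[OF _ order_refl inf_le1])
  then have "(\<lambda>n. interleave \<phi> \<psi> n x) \<longlonglongrightarrow> 0" for x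
    by (simp add: interleave_def if_distribR)
  then show ?thesis
    using assms by (simp add: weak_star_null_def interleave_def)
qed

theorem proposition2p14:
  fixes sE :: "'f::real_normed_field \<Rightarrow> 'e::{ab_group_add, t2_space} \<Rightarrow> 'e"
    and sL :: "'f \<Rightarrow> 'l::{ab_group_add, t2_space} \<Rightarrow> 'l"
  assumes "locally_convex_space sE" and "locally_convex_space sL"
  shows "strongly_Gelfand_Phillips (module_prod.scale sE sL) \<longleftrightarrow>
    strongly_Gelfand_Phillips sE \<and> strongly_Gelfand_Phillips sL"
proof -
  interpret E: locally_convex_space sE by fact
  interpret L: locally_convex_space sL by fact
  interpret P: vector_space_prod sE sL ..
  interpret Q: locally_convex_space P.scale
    using assms by (rule locally_convex_space_prod)
  let ?i = "\<lambda>x::'e. (x, 0::'l)" and ?j = "\<lambda>y::'l. (0::'e, y)"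
  have i: "Vector_Spaces.linear sE P.scale ?i" "continuous_on UNIV ?i"
    by (unfold_locales, simp_all add: P.scale_prod continuous_on_Pair)
  have j: "Vector_Spaces.linear sL P.scale ?j" "continuous_on UNIV ?j"
    by (unfold_locales, simp_all add: P.scale_prod continuous_on_Pair)
  have p: "Vector_Spaces.linear P.scale sE fst" "continuous_on UNIV (fst :: 'e \<times> 'l \<Rightarrow> 'e)"
    by (intro P.linear_fst continuous_on_fst continuous_on_id)+
  have q: "Vector_Spaces.linear P.scale sL snd" "continuous_on UNIV (snd :: 'e \<times> 'l \<Rightarrow> 'l)"
    by (intro P.linear_snd continuous_on_snd continuous_on_id)+
  show ?thesis
  proof (intro iffI conjI)
    assume P: "strongly_Gelfand_Phillips P.scale"
    show "strongly_Gelfand_Phillips sE"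
      by (rule strongly_Gelfand_Phillips_retract[OF i p _ P]) simp
    show "strongly_Gelfand_Phillips sL"
      by (rule strongly_Gelfand_Phillips_retract[OF j q _ P]) simp
  next
    assume "strongly_Gelfand_Phillips sE \<and> strongly_Gelfand_Phillips sL"
    then obtain \<phi> \<psi> where
      \<phi>: "weak_star_null sE \<phi>" "\<And>B. barrel_bounded sE B \<Longrightarrow> \<not> barrel_precompact sE B \<Longrightarrow>
        \<not> (\<lambda>n. sup_seminorm B (\<phi> n)) \<longlonglongrightarrow> 0" and
      \<psi>: "weak_star_null sL \<psi>" "\<And>B. barrel_bounded sL B \<Longrightarrow> \<not> barrel_precompact sL B \<Longrightarrow>
        \<not> (\<lambda>n. sup_seminorm B (\<psi> n)) \<longlonglongrightarrow> 0"
      unfolding strongly_Gelfand_Phillips_def by blast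
    define \<theta> where "\<theta> = interleave (\<lambda>n. \<phi> n \<circ> fst) (\<lambda>n. \<psi> n \<circ> snd)"
    have "weak_star_null P.scale \<theta>"
      unfolding \<theta>_def
      by (intro weak_star_null_interleave weak_star_null_compose[OF p \<phi>(1)]
          weak_star_null_compose[OF q \<psi>(1)])
    \<comment> \<open>The detection property is proved in contrapositive form.\<close>
    moreover have "barrel_precompact P.scale B"
      if B: "barrel_bounded P.scale B" and lim: "(\<lambda>n. sup_seminorm B (\<theta> n)) \<longlonglongrightarrow> 0" for B
    proof -
      \<comment> \<open>The even terms of \<open>\<theta>\<close> are
        \<open>\<phi> n \<circ> fst\<close>, and their seminorm over \<open>B\<close> is that of
        \<open>\<phi> n\<close> over the projection.\<close>
      have "(\<lambda>n. sup_seminorm (fst ` B) (\<phi> n)) \<longlonglongrightarrow> 0"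
        using LIMSEQ_subseq_LIMSEQ[OF lim, of "\<lambda>n. 2 * n"]
        by (simp add: strict_mono_def comp_def \<theta>_def sup_seminorm_image[OF p(1)])
      then have E: "barrel_precompact sE (fst ` B)"
        using \<phi>(2) barrel_bounded_image[OF p B] by blast
      have "(\<lambda>n. sup_seminorm (snd ` B) (\<psi> n)) \<longlonglongrightarrow> 0"
        using LIMSEQ_subseq_LIMSEQ[OF lim, of "\<lambda>n. Suc (2 * n)"]
        by (simp add: strict_mono_def comp_def \<theta>_def sup_seminorm_image[OF q(1)])
      then have L: "barrel_precompact sL (snd ` B)"
        using \<psi>(2) barrel_bounded_image[OF q B] by blast
      \<comment> \<open>Each point splits as \<open>(x, y) = (x, 0) + (0, y)\<close>. The right side
        is the whole product of the projections, so passing to a subset is still required.\<close>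
      have "B \<subseteq> {a + b |a b. a \<in> ?i ` fst ` B \<and> b \<in> ?j ` snd ` B}"
        by force
      then show ?thesis
        using Q.barrel_precompact_plus[OF barrel_precompact_image[OF i E]
            barrel_precompact_image[OF j L]] barrel_precompact_subset by blast
    qed
    ultimately show "strongly_Gelfand_Phillips P.scale"
      unfolding strongly_Gelfand_Phillips_def by blast
  qed
qed

end
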